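(* Let $\alpha,\beta$ be real with $\alpha>-1$ and $\beta\in(0,1+\alpha]$. Then each function $f\in\mathcal{B}_{\mathcal{H}}^0(\alpha,\beta)$ maps $\mathbb{D}$ onto a domain which is bounded by a rectifiable Jordan curve.
   Context: $\mathbb{D}=\{z\in\mathbb{C}:|z|<1\}$. $\mathcal{H}^0$ is the class of harmonic mappings $f=h+\overline{g}$ in $\mathbb{D}$, where $h,g$ are analytic in $\mathbb{D}$ with $h(0)=g(0)=0$, $h'(0)=1$ and $g'(0)=0$. For $\alpha>-1$ and $\beta>0$, $\mathcal{B}_{\mathcal{H}}^0(\alpha,\beta)$ is the set of $f=h+\overline{g}\in\mathcal{H}^0$ such that $|zh''(z)+\alpha(h'(z)-1)|\le \beta-|zg''(z)+\alpha g'(z)|$ for all $z\in\mathbb{D}$. *)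

theory Defs
  imports "HOL-Complex_Analysis.Complex_Analysis"
begin

abbreviation unit_disc :: "complex set" ("\<D>")
  where "\<D> \<equiv> ball 0 1"

text \<open>
  \<open>H0_rep f h g\<close>: on the unit disc, \<open>f\<close> has the form \<open>h + cnj g\<close> with \<open>h\<close>, \<open>g\<close> analytic and
  normalised. The values of \<open>f\<close>, \<open>h\<close>, \<open>g\<close> outside the disc play no role, and on the disc the
  normalisation makes \<open>h\<close> and \<open>g\<close> unique.
\<close>

definition H0_rep :: "(complex \<Rightarrow> complex) \<Rightarrow> (complex \<Rightarrow> complex) \<Rightarrow> (complex \<Rightarrow> complex) \<Rightarrow> bool"
  where "H0_rep f h g \<longleftrightarrow>
    h analytic_on \<D> \<and> g analytic_on \<D> \<and>
    (\<forall>z\<in>\<D>. f z = h z + cnj (g z)) \<and>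
    h 0 = 0 \<and> g 0 = 0 \<and> deriv h 0 = 1 \<and> deriv g 0 = 0"

definition BH0 :: "real \<Rightarrow> real \<Rightarrow> (complex \<Rightarrow> complex) set"
  where "BH0 \<alpha> \<beta> = {f. \<exists>h g. H0_rep f h g \<and>
    (\<forall>z\<in>\<D>. norm (z * deriv (deriv h) z + of_real \<alpha> * (deriv h z - 1))
            \<le> \<beta> - norm (z * deriv (deriv g) z + of_real \<alpha> * deriv g z))}"

text \<open>A path is rectifiable if the lengths of its inscribed polygons are bounded.\<close>

definition rectifiable_path :: "(real \<Rightarrow> 'a::metric_space) \<Rightarrow> bool"
  where "rectifiable_path \<gamma> \<longleftrightarrow> path \<gamma> \<and>
    bdd_above {\<Sum>i<n. dist (\<gamma> (t i)) (\<gamma> (t (Suc i))) | n t.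
      t 0 = 0 \<and> t n = 1 \<and> mono_on {..n} t}"

definition rectifiable_Jordan_curve :: "(real \<Rightarrow> complex) \<Rightarrow> bool"
  where "rectifiable_Jordan_curve \<gamma> \<longleftrightarrow>
    simple_path \<gamma> \<and> pathfinish \<gamma> = pathstart \<gamma> \<and> rectifiable_path \<gamma>"

text \<open>
  The exterior of a Jordan curve is also a connected open set whose frontier is the curve; the
  condition with \<^const>\<open>inside\<close> excludes it.
\<close>

definition domain_bounded_by :: "complex set \<Rightarrow> (real \<Rightarrow> complex) \<Rightarrow> bool"
  where "domain_bounded_by S \<gamma> \<longleftrightarrow>
    open S \<and> connected S \<and> S \<noteq> {} \<and>
    frontier S = path_image \<gamma> \<and> S = inside (path_image \<gamma>)"

end

theory Submission
  imports Defs
begin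

text \<open>
  For \<open>norm \<epsilon> \<le> 1\<close> the function \<open>p = deriv h - 1 + \<epsilon> * deriv g\<close> satisfies
  \<open>norm (z * deriv p z + \<alpha> * p z) \<le> \<beta>\<close>, and hence \<open>norm (p z) \<le> \<beta> / (1 + \<alpha>) * norm z \<le> norm z\<close>.
  Thus \<open>f\<close> is Lipschitz and extends to the closed disc. Since \<open>Re (deriv h + \<epsilon> * deriv g) > 0\<close> on the
  open disc whenever \<open>norm \<epsilon> = 1\<close>, the extension is injective on the closed disc, including the
  extremal case \<open>\<beta> = 1 + \<alpha>\<close>. The image of the unit circle is then a rectifiable Jordan curve, and
  invariance of domain with the Jordan curve theorem identifies its inside as the image of the disc.
\<close>

section \<open>Growth estimates for holomorphic functions on the disc\<close>

text \<open>Schwarz's lemma for \<open>z * r z / B\<close>: away from the origin its growth bound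
  allows cancelling \<open>z\<close>, and at the origin its derivative bound gives the value
  \<open>r 0\<close>.\<close>

lemma norm_le_of_norm_mult_le:
  assumes hol: "r holomorphic_on ball 0 1"
    and le: "\<And>z. norm z < 1 \<Longrightarrow> norm (z * r z) \<le> \<beta>"
    and z: "norm z < 1"
  shows "norm (r z) \<le> \<beta>"
proof (rule dense_ge)
  \<comment> \<open>Schwarz's lemma asks for a function of norm strictly below 1, hence a constant
    \<open>B\<close> above \<beta>, which is then let down to \<beta>.\<close>
  fix B assume "\<beta> < B"
  have "0 \<le> \<beta>" using le[of 0] by simp
  then have B: "B > 0" using \<open>\<beta> < B\<close> by simp
  define q where "q = (\<lambda>z. z * r z / of_real B)"
  have q: "q holomorphic_on ball 0 1" "q 0 = 0"
    using B by (auto simp: q_def intro!: holomorphic_intros hol)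
  have lt: "norm (q w) < 1" if "norm w < 1" for w
    using le[OF that] \<open>\<beta> < B\<close> B by (auto simp: q_def norm_divide)
  show "norm (r z) \<le> B"
  proof (cases "z = 0")
    case True
    have "(r has_field_derivative deriv r 0) (at 0)"
      using hol by (auto intro!: holomorphic_derivI[of _ "ball 0 1"])
    then have "(q has_field_derivative r 0 / of_real B) (at 0)"
      unfolding q_def using B by (auto intro!: derivative_eq_intros)
    then have "deriv q 0 = r 0 / of_real B" by (rule DERIV_imp_deriv)
    then have "norm (r 0 / of_real B) \<le> 1" using Schwarz_Lemma(2)[OF q lt z] by simp
    then show ?thesis using B True by (simp add: norm_divide)
  next
    case False
    then show ?thesis
      using Schwarz_Lemma(1)[OF q lt z] B
      by (simp add: q_def norm_divide norm_mult field_simps)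
  qed
qed

text \<open>At a maximum point \<open>w\<close> of \<open>norm u\<close> on a disc, the radial derivative of
  \<open>Re (cnj (u w) * u)\<close> is nonnegative, so \<open>w * deriv u w\<close> cannot cancel \<open>c * u w\<close>.\<close>

lemma norm_le_of_Euler_operator:
  assumes hol: "u holomorphic_on ball 0 1" and c: "c > 0"
    and le: "\<And>z. norm z < 1 \<Longrightarrow> norm (z * deriv u z + of_real c * u z) \<le> \<beta>"
    and z: "norm z < 1"
  shows "norm (u z) \<le> \<beta> / c"
proof -
  have "continuous_on (cball 0 (norm z)) (\<lambda>x. norm (u x))"
    using z by (intro continuous_intros continuous_on_subset[OF holomorphic_on_imp_continuous_on[OF hol]]) auto
  then obtain w where w: "w \<in> cball 0 (norm z)"
    and max: "\<And>x. x \<in> cball 0 (norm z) \<Longrightarrow> norm (u x) \<le> norm (u w)"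
    using continuous_attains_sup[OF compact_cball, of 0 "norm z"] by force
  have w1: "norm w < 1" using w z by simp
  define \<phi> where "\<phi> = (\<lambda>t::real. Re (cnj (u w) * u (of_real t * w)))"
  have "(u has_field_derivative deriv u w) (at (of_real 1 * w))"
    using hol w1 by (auto intro!: holomorphic_derivI[of _ "ball 0 1"])
  then have "((\<lambda>t. u (of_real t * w)) has_vector_derivative w * deriv u w) (at 1)"
    by (intro field_vector_diff_chain_at[unfolded o_def])
       (auto intro!: derivative_eq_intros)
  then have "((\<lambda>t. cnj (u w) * u (of_real t * w)) has_vector_derivative
      cnj (u w) * (w * deriv u w)) (at 1)"
    by (rule has_vector_derivative_mult_right)
  then have D: "(\<phi> has_real_derivative Re (cnj (u w) * (w * deriv u w))) (at 1)"
    unfolding \<phi>_def has_real_derivative_iff_has_vector_derivative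
    by (rule bounded_linear.has_vector_derivative[OF bounded_linear_Re])
  have \<phi>1: "\<phi> 1 = (norm (u w))\<^sup>2"
    unfolding cmod_power2 by (simp add: \<phi>_def power2_eq_square)
  have le1: "\<phi> t \<le> \<phi> 1" if "0 \<le> t" "t \<le> 1" for t
  proof -
    have "norm (of_real t * w) \<le> norm z"
      using that w mult_mono[of t 1 "norm w" "norm z"] by (simp add: norm_mult)
    then have "norm (u w) * norm (u (of_real t * w)) \<le> (norm (u w))\<^sup>2"
      unfolding power2_eq_square by (intro mult_left_mono max) auto
    moreover have "\<phi> t \<le> norm (u w) * norm (u (of_real t * w))"
      unfolding \<phi>_def using complex_Re_le_cmod[of "cnj (u w) * u (of_real t * w)"]
      by (simp add: norm_mult)
    ultimately show ?thesis by (simp add: \<phi>1)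
  qed
  have nonneg: "Re (cnj (u w) * (w * deriv u w)) \<ge> 0"
  proof (rule ccontr)
    assume "\<not> ?thesis"
    then obtain d where "d > 0" and d: "\<And>h. 0 < h \<Longrightarrow> h < d \<Longrightarrow> \<phi> 1 < \<phi> (1 - h)"
      using DERIV_neg_dec_left[OF D] by auto
    \<comment> \<open>The step \<open>min (d/2) 1\<close> is shorter than \<open>d\<close> and keeps
      the parameter in the range where \<open>le1\<close> applies.\<close>
    have "\<phi> 1 < \<phi> (1 - min (d/2) 1)" using \<open>d > 0\<close> by (intro d) auto
    moreover have "\<phi> (1 - min (d/2) 1) \<le> \<phi> 1" using \<open>d > 0\<close> by (intro le1) auto
    ultimately show False by simp
  qed
  have "c * (norm (u w))\<^sup>2 \<le> Re (cnj (u w) * (w * deriv u w)) + c * (norm (u w))\<^sup>2"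
    using nonneg by simp
  also have "\<dots> = Re (cnj (u w) * (w * deriv u w + of_real c * u w))"
    unfolding cmod_power2 by (simp add: power2_eq_square algebra_simps)
  also have "\<dots> \<le> norm (u w) * norm (w * deriv u w + of_real c * u w)"
    using complex_Re_le_cmod[of "cnj (u w) * (w * deriv u w + of_real c * u w)"]
    by (simp add: norm_mult)
  also have "\<dots> \<le> norm (u w) * \<beta>"
    by (intro mult_left_mono le w1) auto
  finally have *: "norm (u w) * (c * norm (u w)) \<le> norm (u w) * \<beta>"
    by (simp add: power2_eq_square mult_ac)
  \<comment> \<open>Covers the case \<open>u w = 0\<close>, in which \<open>*\<close> cannot be
    divided by \<open>norm (u w)\<close>.\<close>
  have "0 \<le> \<beta>" using order_trans[OF norm_ge_zero le[OF z]] .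
  with * c have "norm (u w) \<le> \<beta> / c"
    by (cases "u w = 0") (auto simp: field_simps)
  with max[of z] show ?thesis by simp
qed

text \<open>Writing \<open>p z = z * u z\<close> turns the operator into
  \<open>z * (z * deriv u z + (1 + \<alpha>) * u z)\<close>. The outer factor \<open>z\<close> is
  cancelled by Schwarz's lemma, and the maximum point argument with \<open>c = 1 + \<alpha>\<close>
  then bounds \<open>u\<close>.\<close>

lemma norm_le_of_differential_bound:
  assumes hol: "p holomorphic_on ball 0 1" and p0: "p 0 = 0" and \<alpha>: "\<alpha> > -1"
    and le: "\<And>z. norm z < 1 \<Longrightarrow> norm (z * deriv p z + of_real \<alpha> * p z) \<le> \<beta>"
    and z: "norm z < 1"
  shows "norm (p z) \<le> \<beta> / (1 + \<alpha>) * norm z"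
proof -
  obtain u where u: "u holomorphic_on ball 0 1" and pu: "\<And>z. norm z < 1 \<Longrightarrow> p z = z * u z"
    using Schwarz3[OF hol p0] by metis
  define r where "r = (\<lambda>z. z * deriv u z + of_real (1 + \<alpha>) * u z)"
  have holr: "r holomorphic_on ball 0 1"
    unfolding r_def by (intro holomorphic_intros u) auto
  have "norm (w * r w) \<le> \<beta>" if w: "norm w < 1" for w
  proof -
    have "(u has_field_derivative deriv u w) (at w)"
      using u w by (auto intro!: holomorphic_derivI[of _ "ball 0 1"])
    then have "((\<lambda>z. z * u z) has_field_derivative (u w + w * deriv u w)) (at w)"
      by (auto intro!: derivative_eq_intros)
    then have "(p has_field_derivative (u w + w * deriv u w)) (at w)"
      by (rule has_field_derivative_transform_within_open[of _ _ _ "ball 0 1"]) (use w pu in auto)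
    then have "deriv p w = u w + w * deriv u w" by (rule DERIV_imp_deriv)
    then have "w * r w = w * deriv p w + of_real \<alpha> * p w"
      using pu[OF w] by (simp add: r_def algebra_simps)
    then show ?thesis using le[OF w] by simp
  qed
  then have "norm (r w) \<le> \<beta>" if "norm w < 1" for w
    using norm_le_of_norm_mult_le[OF holr _ that] by blast
  then have "norm (u z) \<le> \<beta> / (1 + \<alpha>)"
    using norm_le_of_Euler_operator[OF u, of "1 + \<alpha>" \<beta> z] \<alpha> z unfolding r_def by auto
  then show ?thesis
    using pu[OF z] mult_right_mono[of "norm (u z)" "\<beta> / (1 + \<alpha>)" "norm z"] by (simp add: norm_mult mult.commute)
qed

section \<open>Rectifiable curves and Jordan domains\<close>

lemma rectifiable_path_of_lipschitz:
  assumes "C-lipschitz_on {0..1} \<gamma>"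
  shows "rectifiable_path \<gamma>"
  unfolding rectifiable_path_def
proof (intro conjI bdd_aboveI)
  show "path \<gamma>"
    using lipschitz_on_continuous_on[OF assms] by (simp add: path_def)
next
  fix s
  assume "s \<in> {\<Sum>i<n. dist (\<gamma> (t i)) (\<gamma> (t (Suc i))) | n t.
      t 0 = 0 \<and> t n = 1 \<and> mono_on {..n} t}"
  then obtain n and t :: "nat \<Rightarrow> real" where s: "s = (\<Sum>i<n. dist (\<gamma> (t i)) (\<gamma> (t (Suc i))))"
    and t: "t 0 = 0" "t n = 1" "mono_on {..n} t" by auto
  have mono: "t i \<le> t j" if "i \<le> j" "j \<le> n" for i j
    using t(3) that by (auto simp: mono_on_def)
  have "dist (\<gamma> (t i)) (\<gamma> (t (Suc i))) \<le> C * (t (Suc i) - t i)" if "i < n" for i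
    \<comment> \<open>Comparison with the indices 0 and \<open>n\<close> places both partition
      points in \<open>{0..1}\<close>.\<close>
    using lipschitz_onD[OF assms, of "t i" "t (Suc i)"] mono[of 0 i] mono[of i "Suc i"]
      mono[of "Suc i" n] mono[of 0 "Suc i"] mono[of i n] that t
    by (simp add: dist_real_def)
  then have "s \<le> (\<Sum>i<n. C * (t (Suc i) - t i))"
    unfolding s by (intro sum_mono) auto
  also have "\<dots> = C"
    using t by (simp add: sum_distrib_left[symmetric] sum_lessThan_telescope)
  finally show "s \<le> C" .
qed

lemma lipschitz_circlepath: "(2 * pi * \<bar>r\<bar>)-lipschitz_on X (circlepath z r)"
proof (rule lipschitz_onI)
  fix x y :: real
  \<comment> \<open>The parametrisation is extended to a complex variable so that the mean value
    bound for complex derivatives applies on the convex set of reals, where the exponential has norm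
    1.\<close>
  define e where "e = (\<lambda>w. z + of_real r * exp (2 * of_real pi * \<i> * w))"
  have "norm (e (of_real x) - e (of_real y)) \<le> 2 * pi * \<bar>r\<bar> * norm (of_real x - of_real y :: complex)"
  proof (rule field_differentiable_bound)
    show "convex (\<real> :: complex set)" by (simp add: Reals_def convex_linear_image linear_of_real)
    fix w :: complex assume "w \<in> \<real>"
    show "(e has_field_derivative of_real r * (2 * of_real pi * \<i> * exp (2 * of_real pi * \<i> * w)))
        (at w within \<real>)"
      unfolding e_def by (auto intro!: derivative_eq_intros)
    show "norm (of_real r * (2 * of_real pi * \<i> * exp (2 * of_real pi * \<i> * w))) \<le> 2 * pi * \<bar>r\<bar>"
      using \<open>w \<in> \<real>\<close> by (auto simp: norm_mult Reals_def)
  qed auto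
  then show "dist (circlepath z r x) (circlepath z r y) \<le> 2 * pi * \<bar>r\<bar> * dist x y"
    by (simp add: circlepath e_def dist_norm del: of_real_diff flip: of_real_diff)
qed auto

text \<open>A bounded open set lies inside its frontier. Conversely, the inside of the curve is
  connected and misses the frontier of \<open>S\<close>, so it cannot contain points both of
  \<open>S\<close> and of its complement.\<close>

lemma inside_Jordan_curve_eq:
  fixes S :: "complex set"
  assumes \<gamma>: "simple_path \<gamma>" "pathfinish \<gamma> = pathstart \<gamma>"
    and S: "open S" "bounded S" "S \<noteq> {}" and fr: "frontier S = path_image \<gamma>"
  shows "inside (path_image \<gamma>) = S"
proof
  show sub: "S \<subseteq> inside (path_image \<gamma>)"
    using interior_inside_frontier[OF S(2)] S(1) fr by (simp add: interior_open)
  show "inside (path_image \<gamma>) \<subseteq> S"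
  proof (rule ccontr)
    assume "\<not> ?thesis"
    then have "inside (path_image \<gamma>) \<inter> frontier S \<noteq> {}"
      using sub S(3) Jordan_inside_outside[OF \<gamma>] by (intro connected_Int_frontier) auto
    then show False by (simp add: fr inside_no_overlap)
  qed
qed

text \<open>By compactness the closure of the image of the disc is the image of the closed disc; by
  injectivity removing the open image leaves exactly the image of the circle.\<close>

lemma domain_bounded_by_image_circle:
  assumes lip: "C-lipschitz_on (cball 0 1) F" and inj: "inj_on F (cball 0 1)"
  shows "rectifiable_Jordan_curve (F \<circ> circlepath 0 1)"
    and "domain_bounded_by (F ` \<D>) (F \<circ> circlepath 0 1)"
proof -
  have cont: "continuous_on (cball 0 1) F" using lip by (rule lipschitz_on_continuous_on)
  have sph: "sphere 0 1 \<subseteq> cball (0::complex) 1" by auto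
  have img: "path_image (F \<circ> circlepath 0 1) = F ` sphere 0 1"
    by (simp add: path_image_compose)
  have simple: "simple_path (F \<circ> circlepath 0 1)"
    by (intro simple_path_continuous_image)
       (use sph in \<open>auto simp: simple_path_circlepath intro: continuous_on_subset[OF cont] inj_on_subset[OF inj]\<close>)
  have closed: "pathfinish (F \<circ> circlepath 0 1) = pathstart (F \<circ> circlepath 0 1)"
    by (simp add: pathfinish_compose pathstart_compose)
  have ss: "circlepath 0 1 ` {0..1} \<subseteq> cball 0 1"
    using path_image_circlepath[of 0 1] sph by (simp add: path_image_def)
  have "(C * (2 * pi * \<bar>1\<bar>))-lipschitz_on {0..1} (F \<circ> circlepath 0 1)"
    by (intro lipschitz_on_compose lipschitz_circlepath lipschitz_on_subset[OF lip ss])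
  then show "rectifiable_Jordan_curve (F \<circ> circlepath 0 1)"
    unfolding rectifiable_Jordan_curve_def
    using simple closed rectifiable_path_of_lipschitz by blast
  have "open (F ` \<D>)"
    by (intro invariance_of_domain continuous_on_subset[OF cont] inj_on_subset[OF inj]) auto
  have "connected (F ` \<D>)"
    by (intro connected_continuous_image continuous_on_subset[OF cont]) auto
  have cpt: "compact (F ` cball 0 1)" by (intro compact_continuous_image cont compact_cball)
  have "closure (F ` \<D>) = F ` cball 0 1"
  proof
    show "closure (F ` \<D>) \<subseteq> F ` cball 0 1"
      by (intro closure_minimal image_mono compact_imp_closed cpt) auto
    show "F ` cball 0 1 \<subseteq> closure (F ` \<D>)"
      using image_closure_subset[of \<D> F "closure (F ` \<D>)"] cont
      by (simp add: closure_subset)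
  qed
  then have "frontier (F ` \<D>) = F ` cball 0 1 - F ` \<D>"
    using \<open>open (F ` \<D>)\<close> by (simp add: frontier_def interior_open)
  also have "\<dots> = F ` (cball 0 1 - \<D>)"
    by (rule inj_on_image_set_diff[OF inj, symmetric]) auto
  also have "cball 0 1 - \<D> = sphere (0::complex) 1" by auto
  finally have fr: "frontier (F ` \<D>) = path_image (F \<circ> circlepath 0 1)" by (simp add: img)
  have "bounded (F ` \<D>)"
    using compact_imp_bounded[OF cpt] by (rule bounded_subset) auto
  then have "inside (path_image (F \<circ> circlepath 0 1)) = F ` \<D>"
    using \<open>open (F ` \<D>)\<close> by (intro inside_Jordan_curve_eq simple closed fr) auto
  then show "domain_bounded_by (F ` \<D>) (F \<circ> circlepath 0 1)"
    unfolding domain_bounded_by_def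
    using \<open>open (F ` \<D>)\<close> \<open>connected (F ` \<D>)\<close> fr by auto
qed

section \<open>Lipschitz continuity and injectivity of harmonic mappings\<close>

lemma lipschitz_on_harmonic:
  assumes h: "h holomorphic_on \<D>" and g: "g holomorphic_on \<D>"
    and h_le: "\<And>z. norm z < 1 \<Longrightarrow> norm (deriv h z) \<le> A"
    and g_le: "\<And>z. norm z < 1 \<Longrightarrow> norm (deriv g z) \<le> B"
  shows "(A + B)-lipschitz_on \<D> (\<lambda>z. h z + cnj (g z))"
proof -
  have lip: "E-lipschitz_on \<D> k"
    if k: "k holomorphic_on \<D>" and le: "\<And>z. norm z < 1 \<Longrightarrow> norm (deriv k z) \<le> E" for k E
  proof (rule lipschitz_onI)
    show "0 \<le> E" using order_trans[OF norm_ge_zero le[of 0]] by simp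
    fix x y :: complex assume "x \<in> \<D>" "y \<in> \<D>"
    then show "dist (k x) (k y) \<le> E * dist x y"
      unfolding dist_norm
      by (intro field_differentiable_bound[where S = \<D> and f' = "deriv k"])
         (auto intro: holomorphic_derivI[OF k] le)
  qed
  have "B-lipschitz_on \<D> (\<lambda>z. cnj (g z))"
    using lip[OF g g_le] by (simp add: lipschitz_on_def dist_norm flip: complex_cnj_diff)
  then show ?thesis
    by (intro lipschitz_on_add lip[OF h h_le])
qed

text \<open>
  Along the segment from \<open>w\<close> to \<open>z\<close>, with \<open>d = z - w\<close>, the function \<open>Re (cnj d * F)\<close> has derivative
  \<open>(norm d)\<^sup>2 * Re (deriv h + (d / cnj d) * deriv g)\<close>. By strict convexity of the disc the open
  segment avoids the unit circle even when \<open>z\<close> and \<open>w\<close> lie on it.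
\<close>

lemma inj_on_cball_harmonic:
  assumes h: "h holomorphic_on \<D>" and g: "g holomorphic_on \<D>"
    and pos: "\<And>z \<epsilon>. norm z < 1 \<Longrightarrow> norm \<epsilon> = 1 \<Longrightarrow> Re (deriv h z + \<epsilon> * deriv g z) > 0"
    and cont: "continuous_on (cball 0 1) F"
    and F: "\<And>z. norm z < 1 \<Longrightarrow> F z = h z + cnj (g z)"
  shows "inj_on F (cball 0 1)"
proof (rule inj_onI, rule ccontr)
  fix z w assume zw: "z \<in> cball 0 1" "w \<in> cball 0 1" and eq: "F z = F w" and "z \<noteq> w"
  define d where "d = z - w"
  have d: "d \<noteq> 0" using \<open>z \<noteq> w\<close> by (simp add: d_def)
  define \<sigma> where "\<sigma> = (\<lambda>t::real. w + of_real t * d)"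
  have \<sigma>_conv: "\<sigma> t = (1 - t) *\<^sub>R w + t *\<^sub>R z" for t
    by (simp add: \<sigma>_def d_def scaleR_conv_of_real algebra_simps)
  have \<sigma>_cball: "\<sigma> t \<in> cball 0 1" if "0 \<le> t" "t \<le> 1" for t
    unfolding \<sigma>_conv using convexD_alt[OF convex_cball zw(2,1)] that by blast
  have \<sigma>_ball: "norm (\<sigma> t) < 1" if "0 < t" "t < 1" for t
  proof -
    have "\<sigma> t \<in> open_segment w z"
      using that \<open>z \<noteq> w\<close> by (auto simp: in_segment \<sigma>_conv)
    then show ?thesis
      using zw dist_decreases_open_segment[of "\<sigma> t" w z 0] by auto
  qed
  have "Re (cnj d * F (\<sigma> 0)) < Re (cnj d * F (\<sigma> 1))"
  proof (rule DERIV_pos_imp_increasing_open[where f = "\<lambda>t. Re (cnj d * F (\<sigma> t))"])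
    have "continuous_on {0..1} (\<lambda>t. F (\<sigma> t))"
      using \<sigma>_cball by (intro continuous_on_compose2[OF cont]) (auto simp: \<sigma>_def intro!: continuous_intros)
    then show "continuous_on {0..1} (\<lambda>t. Re (cnj d * F (\<sigma> t)))"
      by (intro continuous_intros)
    fix t :: real assume t: "0 < t" "t < 1"
    note s = \<sigma>_ball[OF t]
    have D: "((\<lambda>t. k (\<sigma> t)) has_vector_derivative d * deriv k (\<sigma> t)) (at t)"
      if "k holomorphic_on \<D>" for k
    proof -
      have "(k has_field_derivative deriv k (\<sigma> t)) (at (\<sigma> t))"
        using that s by (auto intro!: holomorphic_derivI[of _ \<D>])
      then show ?thesis
        by (intro field_vector_diff_chain_at[unfolded o_def])
           (auto simp: \<sigma>_def intro!: derivative_eq_intros)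
    qed
    \<comment> \<open>As \<open>cnj d * cnj (g z)\<close> and \<open>d * g z\<close> have the same
      real part, \<open>g\<close> can replace its conjugate, and complex derivatives are
      available.\<close>
    have "((\<lambda>t. cnj d * h (\<sigma> t) + d * g (\<sigma> t)) has_vector_derivative
        cnj d * (d * deriv h (\<sigma> t)) + d * (d * deriv g (\<sigma> t))) (at t)"
      by (intro has_vector_derivative_add has_vector_derivative_mult_right D h g)
    then have "((\<lambda>t. Re (cnj d * h (\<sigma> t) + d * g (\<sigma> t))) has_real_derivative
        Re (cnj d * (d * deriv h (\<sigma> t)) + d * (d * deriv g (\<sigma> t)))) (at t)"
      unfolding has_real_derivative_iff_has_vector_derivative
      by (rule bounded_linear.has_vector_derivative[OF bounded_linear_Re])
    \<comment> \<open>The factor \<open>d / cnj d\<close> has norm 1, so \<open>pos\<close> applies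
      with it as \<epsilon>.\<close>
    moreover have "cnj d * (d * deriv h (\<sigma> t)) + d * (d * deriv g (\<sigma> t)) =
        of_real ((norm d)\<^sup>2) * (deriv h (\<sigma> t) + (d / cnj d) * deriv g (\<sigma> t))"
      unfolding complex_norm_square using d by (simp add: field_simps)
    moreover have "Re (of_real ((norm d)\<^sup>2) * (deriv h (\<sigma> t) + (d / cnj d) * deriv g (\<sigma> t))) > 0"
      unfolding scaleR_conv_of_real[symmetric] scaleR_complex.simps(1) using d
      by (intro mult_pos_pos pos s) (auto simp: norm_divide)
    ultimately have *: "((\<lambda>t. Re (cnj d * h (\<sigma> t) + d * g (\<sigma> t))) has_real_derivative
        Re (of_real ((norm d)\<^sup>2) * (deriv h (\<sigma> t) + (d / cnj d) * deriv g (\<sigma> t)))) (at t)"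
      by simp
    have "((\<lambda>t. Re (cnj d * F (\<sigma> t))) has_real_derivative
        Re (of_real ((norm d)\<^sup>2) * (deriv h (\<sigma> t) + (d / cnj d) * deriv g (\<sigma> t)))) (at t)"
      by (rule has_field_derivative_transform_within_open[OF *, of "{0<..<1}"])
         (use t in \<open>auto simp: F \<sigma>_ball algebra_simps\<close>)
    then show "\<exists>y. ((\<lambda>t. Re (cnj d * F (\<sigma> t))) has_real_derivative y) (at t) \<and> y > 0"
      using \<open>Re (of_real ((norm d)\<^sup>2) * _) > 0\<close> by blast
  qed auto
  then show False using eq by (simp add: \<sigma>_def d_def)
qed

section \<open>Application to the given class of harmonic mappings\<close>

theorem theorem2p6:
  fixes \<alpha> \<beta> :: real and f :: "complex \<Rightarrow> complex"
  assumes "\<alpha> > -1" and "\<beta> > 0" and "\<beta> \<le> 1 + \<alpha>"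
    and "f \<in> BH0 \<alpha> \<beta>"
  shows "\<exists>\<gamma>. rectifiable_Jordan_curve \<gamma> \<and> domain_bounded_by (f ` \<D>) \<gamma>"
proof -
  obtain h g where rep: "H0_rep f h g"
    and le: "\<And>z. norm z < 1 \<Longrightarrow> norm (z * deriv (deriv h) z + of_real \<alpha> * (deriv h z - 1))
            + norm (z * deriv (deriv g) z + of_real \<alpha> * deriv g z) \<le> \<beta>"
    using assms(4) unfolding BH0_def by (force simp: algebra_simps)
  have h: "h holomorphic_on \<D>" and g: "g holomorphic_on \<D>"
    using rep by (auto simp: H0_rep_def analytic_imp_holomorphic)
  note dh = holomorphic_deriv[OF h open_ball] and dg = holomorphic_deriv[OF g open_ball]
  have bound: "norm (deriv h z - 1 + \<epsilon> * deriv g z) \<le> norm z"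
    if z: "norm z < 1" and \<epsilon>: "norm \<epsilon> \<le> 1" for z \<epsilon>
  proof -
    have "norm (deriv h z - 1 + \<epsilon> * deriv g z) \<le> \<beta> / (1 + \<alpha>) * norm z"
    proof (rule norm_le_of_differential_bound[where p = "\<lambda>z. deriv h z - 1 + \<epsilon> * deriv g z"])
      fix w :: complex assume w: "norm w < 1"
      have "(deriv h has_field_derivative deriv (deriv h) w) (at w)"
           "(deriv g has_field_derivative deriv (deriv g) w) (at w)"
        using dh dg w by (auto intro!: holomorphic_derivI[of _ \<D>])
      then have "((\<lambda>z. deriv h z - 1 + \<epsilon> * deriv g z) has_field_derivative
          deriv (deriv h) w + \<epsilon> * deriv (deriv g) w) (at w)"
        by (auto intro!: derivative_eq_intros)
      then have *: "deriv (\<lambda>z. deriv h z - 1 + \<epsilon> * deriv g z) w =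
          deriv (deriv h) w + \<epsilon> * deriv (deriv g) w"
        by (rule DERIV_imp_deriv)
      have "norm (w * deriv (\<lambda>z. deriv h z - 1 + \<epsilon> * deriv g z) w
            + of_real \<alpha> * (deriv h w - 1 + \<epsilon> * deriv g w)) =
          norm ((w * deriv (deriv h) w + of_real \<alpha> * (deriv h w - 1))
            + \<epsilon> * (w * deriv (deriv g) w + of_real \<alpha> * deriv g w))"
        unfolding * by (simp add: algebra_simps)
      also have "\<dots> \<le> norm (w * deriv (deriv h) w + of_real \<alpha> * (deriv h w - 1))
            + norm \<epsilon> * norm (w * deriv (deriv g) w + of_real \<alpha> * deriv g w)"
        by (metis norm_triangle_ineq norm_mult)
      also have "\<dots> \<le> norm (w * deriv (deriv h) w + of_real \<alpha> * (deriv h w - 1))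
            + norm (w * deriv (deriv g) w + of_real \<alpha> * deriv g w)"
        using mult_right_mono[OF \<epsilon>] by auto
      also have "\<dots> \<le> \<beta>" by (rule le[OF w])
      finally show "norm (w * deriv (\<lambda>z. deriv h z - 1 + \<epsilon> * deriv g z) w
            + of_real \<alpha> * (deriv h w - 1 + \<epsilon> * deriv g w)) \<le> \<beta>" .
    qed (use dh dg rep assms z in \<open>auto simp: H0_rep_def intro!: holomorphic_intros\<close>)
    also have "\<dots> \<le> 1 * norm z"
      using assms by (intro mult_right_mono) auto
    finally show ?thesis by simp
  qed
  have h_le: "norm (deriv h z) \<le> 2" if "norm z < 1" for z
    using bound[OF that, of 0] that norm_triangle_ineq[of "deriv h z - 1" 1] by simp
  have g_le: "norm (deriv g z) \<le> 2" if "norm z < 1" for z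
    using bound[OF that, of 0] bound[OF that, of 1] that
      norm_triangle_ineq4[of "deriv h z - 1 + deriv g z" "deriv h z - 1"] by simp
  \<comment> \<open>Strict because \<open>norm z < 1\<close>, even if
    \<open>\<beta> = 1 + \<alpha>\<close>.\<close>
  have pos: "Re (deriv h z + \<epsilon> * deriv g z) > 0" if "norm z < 1" "norm \<epsilon> = 1" for z \<epsilon>
    using bound[OF that(1), of \<epsilon>] that abs_Re_le_cmod[of "deriv h z - 1 + \<epsilon> * deriv g z"] by simp
  \<comment> \<open>A Lipschitz map into a complete space extends to the closure with the same
    constant. The boundary curve is built from \<open>F\<close>, since \<open>f\<close> is
    prescribed only on the open disc.\<close>
  obtain F where F: "(2 + 2)-lipschitz_on (cball 0 1) F"
    and eq: "\<And>z. z \<in> \<D> \<Longrightarrow> F z = h z + cnj (g z)"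
    using lipschitz_extend_closure[OF lipschitz_on_harmonic[OF h g h_le g_le]] by auto
  have "inj_on F (cball 0 1)"
    using inj_on_cball_harmonic[OF h g pos lipschitz_on_continuous_on[OF F]] eq by simp
  moreover have "f ` \<D> = F ` \<D>"
    using rep eq by (intro image_cong) (auto simp: H0_rep_def)
  ultimately show ?thesis
    using domain_bounded_by_image_circle[OF F] by metis
qed

end
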